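(* Let $A$ be a C*-algebra and $B$ a hereditary C*-subalgebra of $A$. Then $$\mathrm c_B[B]^\perp=\{B\cap C: C\in\mathrm c[A]^\perp\},$$ where $\mathrm c[A]^\perp$ is the set of central elements of the ortholattice $[A]^\perp$ of annihilators of $A$, and $\mathrm c_B[B]^\perp$ is the set of central elements of the ortholattice $[B]^\perp$ of annihilators of the C*-algebra $B$ (computed within $B$).
   Context: For a C*-algebra $A$ and $a,b\in A$ write $a\perp b$ if $ab=0=ab^*$, and for $S\subseteq A$ put $S^\perp=\{b\in A:s\perp b\text{ for all }s\in S\}$. An annihilator of $A$ is a set of the form $S^\perp$, $S\subseteq A$; $[A]^\perp$ is the set of annihilators. Ordered by inclusion, it is a complete ortholattice with infima given by intersection, $\bigvee\mathcal B=(\bigcup\mathcal B)^{\perp\perp}$ and orthocomplementation $B\mapsto B^\perp$. For a C*-subalgebra $B$, $[B]^\perp$ is the same object formed with $B$ in place of $A$: its elements are the sets $S^{\perp_B}=S^\perp\cap B$ with $S\subseteq B$, with orthocomplementation $C\mapsto C^{\perp_B}=C^\perp\cap B$. In an ortholattice, $s,t$ commute if both distributive laws $p\wedge(q\vee r)=(p\wedge q)\vee(p\wedge r)$ and $p\vee(q\wedge r)=(p\vee q)\wedge(p\vee r)$ hold for all $p,q,r\in\{s,s^\perp,t,t^\perp\}$; an element is central if it commutes with every element. *)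

theory Defs
  imports "HOL-Analysis.Analysis"
begin

text \<open>Complex C*-algebras, not necessarily unital; the zero algebra is allowed.\<close>

class cstar_algebra = real_normed_algebra + banach +
  fixes scaleC :: "complex \<Rightarrow> 'a \<Rightarrow> 'a"  (infixr \<open>*\<^sub>C\<close> 75)
    and star :: "'a \<Rightarrow> 'a"
  assumes scaleC_add_right: "c *\<^sub>C (x + y) = c *\<^sub>C x + c *\<^sub>C y"
    and scaleC_add_left: "(c + d) *\<^sub>C x = c *\<^sub>C x + d *\<^sub>C x"
    and scaleC_scaleC: "c *\<^sub>C (d *\<^sub>C x) = (c * d) *\<^sub>C x"
    and scaleC_of_real: "complex_of_real r *\<^sub>C x = r *\<^sub>R x"
    and mult_scaleC_left: "(c *\<^sub>C x) * y = c *\<^sub>C (x * y)"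
    and mult_scaleC_right: "x * (c *\<^sub>C y) = c *\<^sub>C (x * y)"
    and norm_scaleC: "norm (c *\<^sub>C x) = cmod c * norm x"
    and star_star: "star (star x) = x"
    and star_add: "star (x + y) = star x + star y"
    and star_scaleC: "star (c *\<^sub>C x) = cnj c *\<^sub>C star x"
    and star_mult: "star (x * y) = star y * star x"
    and cstar_identity: "norm (star x * x) = (norm x)\<^sup>2"

definition positive :: "'a::cstar_algebra \<Rightarrow> bool" where
  "positive a \<longleftrightarrow> (\<exists>x. a = star x * x)"

definition cstar_subalgebra :: "'a::cstar_algebra set \<Rightarrow> bool" where
  "cstar_subalgebra B \<longleftrightarrow> closed B \<and> 0 \<in> B \<and>
     (\<forall>x\<in>B. \<forall>y\<in>B. x + y \<in> B) \<and> (\<forall>c. \<forall>x\<in>B. c *\<^sub>C x \<in> B) \<and>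
     (\<forall>x\<in>B. \<forall>y\<in>B. x * y \<in> B) \<and> (\<forall>x\<in>B. star x \<in> B)"

text \<open>The order condition \<open>0 \<le> a \<le> b \<in> B \<Longrightarrow> a \<in> B\<close>, where \<open>a \<le> b\<close> means that \<open>b - a\<close> is positive
  in the whole algebra.\<close>

definition hereditary_cstar_subalgebra :: "'a::cstar_algebra set \<Rightarrow> bool" where
  "hereditary_cstar_subalgebra B \<longleftrightarrow> cstar_subalgebra B \<and>
     (\<forall>a. \<forall>b\<in>B. positive a \<and> positive (b - a) \<longrightarrow> a \<in> B)"

definition cperp :: "'a::cstar_algebra \<Rightarrow> 'a \<Rightarrow> bool"  (infix \<open>\<bottom>\<^sub>C\<close> 50) where
  "a \<bottom>\<^sub>C b \<longleftrightarrow> a * b = 0 \<and> a * star b = 0"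

text \<open>For a C*-subalgebra \<open>B\<close>, the annihilators, their lattice operations and the central
  annihilators are all computed inside \<open>B\<close>; the ambient algebra is the case \<open>B = UNIV\<close>.\<close>

definition perp_in :: "'a::cstar_algebra set \<Rightarrow> 'a set \<Rightarrow> 'a set" where
  "perp_in B S = {b \<in> B. \<forall>s\<in>S. s \<bottom>\<^sub>C b}"

definition annihilators :: "'a::cstar_algebra set \<Rightarrow> 'a set set" where
  "annihilators B = {perp_in B S | S. S \<subseteq> B}"

definition join_in :: "'a::cstar_algebra set \<Rightarrow> 'a set \<Rightarrow> 'a set \<Rightarrow> 'a set" where
  "join_in B C D = perp_in B (perp_in B (C \<union> D))"

text \<open>Commutation and centrality for an ortholattice given by its carrier \<open>L\<close> and its
  operations (meet, join, orthocomplement).\<close>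

definition ol_commute ::
  "('b \<Rightarrow> 'b \<Rightarrow> 'b) \<Rightarrow> ('b \<Rightarrow> 'b \<Rightarrow> 'b) \<Rightarrow> ('b \<Rightarrow> 'b) \<Rightarrow> 'b \<Rightarrow> 'b \<Rightarrow> bool" where
  "ol_commute meet join oc s t \<longleftrightarrow>
     (\<forall>p\<in>{s, oc s, t, oc t}. \<forall>q\<in>{s, oc s, t, oc t}. \<forall>r\<in>{s, oc s, t, oc t}.
        meet p (join q r) = join (meet p q) (meet p r) \<and>
        join p (meet q r) = meet (join p q) (join p r))"

definition ol_center ::
  "'b set \<Rightarrow> ('b \<Rightarrow> 'b \<Rightarrow> 'b) \<Rightarrow> ('b \<Rightarrow> 'b \<Rightarrow> 'b) \<Rightarrow> ('b \<Rightarrow> 'b) \<Rightarrow> 'b set" where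
  "ol_center L meet join oc = {s \<in> L. \<forall>t\<in>L. ol_commute meet join oc s t}"

definition central_annihilators :: "'a::cstar_algebra set \<Rightarrow> 'a set set" where
  "central_annihilators B = ol_center (annihilators B) (\<inter>) (join_in B) (perp_in B)"

end

theory Submission
  imports Defs
begin

text \<open>Inside any C*-subalgebra \<open>B\<close>, an annihilator \<open>C\<close> is central exactly when \<open>C B C\<^sup>\<bottom> = 0\<close>, that is,
  when \<open>C\<close> is an ideal of \<open>B\<close> (\<open>central_annihilators_iff_ideal\<close>).  This turns a statement about
  lattices into one about ideals.

  That ideals are central rests on two facts.  In every ortholattice \<open>s\<close> is central as soon as
  \<open>x = (x \<and> s) \<or> (x \<and> s\<^sup>\<bottom>)\<close> for all \<open>x\<close> (\<open>central_iff_splits\<close>).  And an ideal \<open>C\<close> splits every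
  annihilator \<open>D\<close>, since the compressions \<open>d C d\<^sup>*\<close> and \<open>d C\<^sup>\<bottom> d\<^sup>*\<close> by elements \<open>d\<close> of \<open>D\<close> stay in
  \<open>D \<inter> C\<close> and \<open>D \<inter> C\<^sup>\<bottom>\<close>, and nothing but \<open>0\<close> is orthogonal to both \<open>C\<close> and \<open>C\<^sup>\<bottom>\<close>.  Conversely, a
  nonzero \<open>w \<in> C B C\<^sup>\<bottom>\<close> yields an annihilator supported on the graph of \<open>w\<close>; it is nonzero but meets
  both \<open>C\<close> and \<open>C\<^sup>\<bottom>\<close> in \<open>0\<close>, so \<open>C\<close> does not split it (\<open>ideal_of_splits\<close>).

  Heredity of \<open>B\<close> enters through the inclusion \<open>e\<^sup>* a\<^sup>* d f \<in> B\<close> for \<open>e, f \<in> B\<close> and arbitrary \<open>a, d\<close>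
  (\<open>hereditary_compress\<close>).  It shows that \<open>B \<inter> C\<^sup>\<bottom>\<close> is the complement of \<open>B \<inter> C\<close> within \<open>B\<close> when \<open>C\<close>
  is an annihilator ideal of \<open>A\<close>, so that \<open>B \<inter> C\<close> is central (\<open>central_restrict\<close>).  It also upgrades
  \<open>E B F = 0\<close>, for a central \<open>E\<close> in \<open>B\<close> with complement \<open>F\<close>, to \<open>E A F = 0\<close>; hence \<open>E = B \<inter> C\<close> for
  the annihilator \<open>C\<close> of the ideal \<open>A F A\<close> (\<open>central_extend\<close>).\<close>

section \<open>Arithmetic of the involution\<close>

lemma star_zero [simp]: "star (0::'a::cstar_algebra) = 0"
  using star_add[of "0::'a" 0] by simp

lemma star_minus: "star (- x) = - star (x::'a::cstar_algebra)"
  using star_add[of x "- x"] by (simp add: eq_neg_iff_add_eq_0 add.commute)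

lemma star_diff: "star (x - y) = star x - star (y::'a::cstar_algebra)"
  using star_add[of x "- y"] by (simp add: star_minus)

lemma star_scaleR: "star (r *\<^sub>R x) = r *\<^sub>R star (x::'a::cstar_algebra)"
  by (metis complex_cnj_complex_of_real scaleC_of_real star_scaleC)

lemma star_mult_self_eq_0_iff [simp]: "star x * x = 0 \<longleftrightarrow> (x::'a::cstar_algebra) = 0"
  by (metis cstar_identity mult_zero_right norm_eq_zero power_eq_0_iff)

lemma mult_star_self_eq_0_iff [simp]: "x * star x = 0 \<longleftrightarrow> (x::'a::cstar_algebra) = 0"
  by (metis star_mult_self_eq_0_iff star_star star_zero)

lemma star_mult_self_cancel: "star x * x * z = 0 \<longleftrightarrow> x * z = (0::'a::cstar_algebra)"
proof
  assume "star x * x * z = 0"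
  then have "star (x * z) * (x * z) = 0"
    by (simp add: star_mult mult.assoc)
  then show "x * z = 0" by (simp only: star_mult_self_eq_0_iff)
qed (simp add: mult.assoc)

lemma mult_star_self_cancel: "z * (x * star x) = 0 \<longleftrightarrow> z * x = (0::'a::cstar_algebra)"
proof
  assume "z * (x * star x) = 0"
  then have "z * (x * star x) * star z = 0" by simp
  then have "(z * x) * star (z * x) = 0"
    by (simp only: star_mult mult.assoc)
  then show "z * x = 0" by (simp only: mult_star_self_eq_0_iff)
qed (simp flip: mult.assoc)

lemma star_eq_0_iff [simp]: "star x = 0 \<longleftrightarrow> (x::'a::cstar_algebra) = 0"
  by (metis star_star star_zero)

lemma star_mult_mult_eq_0_iff:
  "star c * star b * star a = 0 \<longleftrightarrow> a * b * c = (0::'a::cstar_algebra)"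
  using star_eq_0_iff[of "a * b * c"] by (simp only: star_mult mult.assoc)

lemma norm_star: "norm (star x) = norm (x::'a::cstar_algebra)"
proof -
  have le: "norm y \<le> norm (star y)" for y :: 'a
  proof (cases "y = 0")
    case False
    have "norm y * norm y \<le> norm (star y) * norm y"
      using cstar_identity[of y] norm_mult_ineq[of "star y" y] by (simp add: power2_eq_square)
    then show ?thesis using False by simp
  qed simp
  from le[of x] le[of "star x"] show ?thesis by (simp add: star_star)
qed

section \<open>Hereditary subalgebras\<close>

lemma subalgebraD:
  assumes "cstar_subalgebra B"
  shows subalgebra_zero: "0 \<in> B"
    and subalgebra_add: "x \<in> B \<Longrightarrow> y \<in> B \<Longrightarrow> x + y \<in> B"
    and subalgebra_scaleC: "x \<in> B \<Longrightarrow> c *\<^sub>C x \<in> B"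
    and subalgebra_mult: "x \<in> B \<Longrightarrow> y \<in> B \<Longrightarrow> x * y \<in> B"
    and subalgebra_star: "x \<in> B \<Longrightarrow> star x \<in> B"
    and subalgebra_scaleR: "x \<in> B \<Longrightarrow> r *\<^sub>R x \<in> B"
    and subalgebra_diff: "x \<in> B \<Longrightarrow> y \<in> B \<Longrightarrow> x - y \<in> B"
proof -
  show R: "x \<in> B \<Longrightarrow> r *\<^sub>R x \<in> B" for x r
    using assms unfolding cstar_subalgebra_def by (metis scaleC_of_real)
  show "x \<in> B \<Longrightarrow> y \<in> B \<Longrightarrow> x - y \<in> B"
    using R[of y "-1"] assms unfolding cstar_subalgebra_def by fastforce
qed (use assms in \<open>auto simp: cstar_subalgebra_def\<close>)

lemma cstar_subalgebra_UNIV: "cstar_subalgebra UNIV"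
  by (simp add: cstar_subalgebra_def)

text \<open>With \<open>s = 1 - g\<close> in the unitization, the equation reads \<open>s\<^sup>2 = 1 - h\<close>: this is the square
  root of \<open>1 - h\<close>, found as a fixed point of \<open>g \<mapsto> (h + g\<^sup>2) / 2\<close>, which contracts the ball of
  radius \<open>1/3\<close>.  Uniqueness of the fixed point makes it self-adjoint.\<close>

lemma sqrt_one_minus_ex:
  fixes h :: "'a::cstar_algebra"
  assumes h: "norm h \<le> 1/4" "star h = h"
  obtains g where "star g = g" "2 *\<^sub>R g = h + g * g"
proof -
  define f where "f g = (1/2) *\<^sub>R (h + g * g)" for g :: 'a
  have f_ball: "f g \<in> cball 0 (1/3)" if "g \<in> cball 0 (1/3)" for g
  proof -
    have g: "norm g \<le> 1/3" using that by simp
    have "norm (g * g) \<le> norm g * norm g" by (rule norm_mult_ineq)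
    also have "\<dots> \<le> 1/3 * (1/3)" using g by (intro mult_mono) auto
    finally have "norm (h + g * g) \<le> 1/4 + 1/9"
      using h(1) norm_triangle_ineq[of h "g * g"] by linarith
    then show ?thesis by (simp add: f_def)
  qed
  have f_dist: "dist (f x) (f y) \<le> 1/3 * dist x y"
    if "x \<in> cball 0 (1/3)" "y \<in> cball 0 (1/3)" for x y
  proof -
    have n: "norm x \<le> 1/3" "norm y \<le> 1/3" using that by simp_all
    have eq: "x * x - y * y = x * (x - y) + (x - y) * y" by (simp add: algebra_simps)
    have "norm (x * (x - y)) \<le> 1/3 * norm (x - y)"
      by (rule order_trans[OF norm_mult_ineq]) (use n in \<open>intro mult_right_mono; simp\<close>)
    moreover have "norm ((x - y) * y) \<le> norm (x - y) * (1/3)"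
      by (rule order_trans[OF norm_mult_ineq]) (use n in \<open>intro mult_left_mono; simp\<close>)
    ultimately have "norm (x * x - y * y) \<le> 2/3 * norm (x - y)"
      unfolding eq using norm_triangle_ineq[of "x * (x - y)" "(x - y) * y"] by linarith
    moreover have "f x - f y = (1/2) *\<^sub>R (x * x - y * y)"
      by (simp add: f_def algebra_simps)
    ultimately show ?thesis by (simp add: dist_norm)
  qed
  have "\<exists>!g\<in>cball 0 (1/3). f g = g"
  proof (rule Banach_fix[where c = "1/3"])
    show "complete (cball (0::'a) (1/3))" by (simp add: complete_eq_closed)
    show "f ` cball 0 (1/3) \<subseteq> cball 0 (1/3)" using f_ball by blast
  qed (use f_dist in auto)
  then obtain g where g: "g \<in> cball 0 (1/3)" "f g = g"
    and uniq: "\<And>g'. g' \<in> cball 0 (1/3) \<Longrightarrow> f g' = g' \<Longrightarrow> g' = g" by blast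
  have "f (star g) = star (f g)"
    by (simp add: f_def star_scaleR star_add star_mult h(2))
  then have "star g = g" using g uniq[of "star g"] by (simp add: norm_star)
  moreover have "2 *\<^sub>R g = h + g * g"
  proof -
    have "2 *\<^sub>R f g = h + g * g" by (simp add: f_def)
    then show ?thesis using g(2) by simp
  qed
  ultimately show thesis using that by blast
qed

text \<open>After scaling \<open>a\<close>, put \<open>h = a\<^sup>* a\<close> and let \<open>s\<close> be the square root of \<open>1 - h\<close>.  Then
  \<open>e\<^sup>* e - e\<^sup>* h e = (s e)\<^sup>* (s e)\<close>, so \<open>e\<^sup>* h e\<close> is dominated by an element of \<open>B\<close>.\<close>

lemma hereditary_compress_positive:
  fixes B :: "'a::cstar_algebra set"
  assumes B: "hereditary_cstar_subalgebra B" and e: "e \<in> B"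
  shows "star (a * e) * (a * e) \<in> B"
proof -
  have sub: "cstar_subalgebra B" using B by (simp add: hereditary_cstar_subalgebra_def)
  have small: "star (a * e) * (a * e) \<in> B" if a: "norm a \<le> 1/2" for a
  proof -
    have "norm (star a * a) \<le> 1/4"
      using power_mono[OF a, of 2] by (simp add: cstar_identity power2_eq_square)
    then obtain g where g: "star g = g" "2 *\<^sub>R g = star a * a + g * g"
      using sqrt_one_minus_ex[of "star a * a"] by (auto simp: star_mult star_star)
    have a_eq: "star a * a = g + g - g * g" using g(2) by (simp add: scaleR_2)
    have "star (a * e) * (a * e) = star e * (star a * a) * e"
      by (simp add: star_mult mult.assoc)
    then have "star e * e - star (a * e) * (a * e) = star (e - g * e) * (e - g * e)"
      unfolding a_eq by (simp add: star_diff star_mult g(1) algebra_simps)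
    then have "positive (star e * e - star (a * e) * (a * e))"
      "positive (star (a * e) * (a * e))"
      unfolding positive_def by blast+
    moreover have "star e * e \<in> B" using e sub by (simp add: subalgebraD)
    ultimately show ?thesis using B unfolding hereditary_cstar_subalgebra_def by blast
  qed
  define r where "r = 1 / (2 * (1 + norm a))"
  have pos: "1 + norm a > 0" by (simp add: add_pos_nonneg)
  then have r: "r > 0" by (simp add: r_def)
  have "norm (r *\<^sub>R a) = norm a / (2 * (1 + norm a))" using r by (simp add: r_def)
  also have "\<dots> \<le> 1/2" using pos by (simp add: field_simps)
  finally have "star ((r *\<^sub>R a) * e) * ((r *\<^sub>R a) * e) \<in> B" by (rule small)
  then have "(1/r\<^sup>2) *\<^sub>R (star ((r *\<^sub>R a) * e) * ((r *\<^sub>R a) * e)) \<in> B"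
    by (rule subalgebra_scaleR[OF sub])
  moreover have "(1/r\<^sup>2) *\<^sub>R (star ((r *\<^sub>R a) * e) * ((r *\<^sub>R a) * e)) = star (a * e) * (a * e)"
    using r by (simp only: star_scaleR mult_scaleR_left mult_scaleR_right scaleR_scaleR)
      (simp add: power2_eq_square)
  ultimately show ?thesis by simp
qed

text \<open>For \<open>u = a e\<close> and \<open>v = d f\<close>, the parallelogram law bounds \<open>(u + v)\<^sup>* (u + v)\<close> by
  \<open>2 (u\<^sup>* u + v\<^sup>* v)\<close>, which lies in \<open>B\<close>; polarization then isolates \<open>u\<^sup>* v\<close>.\<close>

lemma hereditary_compress:
  fixes B :: "'a::cstar_algebra set"
  assumes B: "hereditary_cstar_subalgebra B" and ef: "e \<in> B" "f \<in> B"
  shows "star (a * e) * (d * f) \<in> B"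
proof -
  have sub: "cstar_subalgebra B" using B by (simp add: hereditary_cstar_subalgebra_def)
  have sym: "star (a * e) * (d * f) + star (d * f) * (a * e) \<in> B" for d
  proof -
    let ?u = "a * e" and ?v = "d * f"
    have uv: "star ?u * ?u \<in> B" "star ?v * ?v \<in> B"
      using hereditary_compress_positive[OF B] ef by auto
    have "2 *\<^sub>R (star ?u * ?u + star ?v * ?v) - star (?u + ?v) * (?u + ?v)
        = star (?u - ?v) * (?u - ?v)"
      unfolding scaleR_2 star_add star_diff
      by (simp only: distrib_left distrib_right left_diff_distrib right_diff_distrib) simp
    then have "positive (2 *\<^sub>R (star ?u * ?u + star ?v * ?v) - star (?u + ?v) * (?u + ?v))"
      "positive (star (?u + ?v) * (?u + ?v))"
      unfolding positive_def by blast+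
    moreover have "2 *\<^sub>R (star ?u * ?u + star ?v * ?v) \<in> B"
      using uv sub by (simp add: subalgebraD)
    ultimately have "star (?u + ?v) * (?u + ?v) \<in> B"
      using B unfolding hereditary_cstar_subalgebra_def by blast
    then have "star (?u + ?v) * (?u + ?v) - star ?u * ?u - star ?v * ?v \<in> B"
      using uv sub by (simp add: subalgebraD)
    then show ?thesis by (simp add: star_add algebra_simps)
  qed
  let ?p = "star (a * e) * (d * f)" and ?q = "star (d * f) * (a * e)"
  have "star (a * e) * ((\<i> *\<^sub>C d) * f) + star ((\<i> *\<^sub>C d) * f) * (a * e) = \<i> *\<^sub>C ?p + (-\<i>) *\<^sub>C ?q"
    by (simp add: mult_scaleC_left mult_scaleC_right star_scaleC)
  then have "(-\<i>) *\<^sub>C (\<i> *\<^sub>C ?p + (-\<i>) *\<^sub>C ?q) \<in> B"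
    using sym[of "\<i> *\<^sub>C d"] sub by (simp add: subalgebraD)
  moreover have "(-\<i>) *\<^sub>C (\<i> *\<^sub>C ?p + (-\<i>) *\<^sub>C ?q) = ?p - ?q"
    using scaleC_of_real[of 1 ?p] scaleC_of_real[of "-1" ?q]
    by (simp add: scaleC_add_right scaleC_scaleC)
  ultimately have "(?p + ?q) + (?p - ?q) \<in> B"
    using sym[of d] sub by (simp only: subalgebraD)
  then have "(1/2) *\<^sub>R ((?p + ?q) + (?p - ?q)) \<in> B" using sub by (simp only: subalgebraD)
  moreover have "(1/2) *\<^sub>R ((?p + ?q) + (?p - ?q)) = ?p"
    by (simp flip: scaleR_2)
  ultimately show ?thesis by simp
qed

section \<open>Central elements of an ortholattice of sets\<close>

locale set_ortholattice =
  fixes L :: "'b set set" and oc :: "'b set \<Rightarrow> 'b set" and Z :: "'b set"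
  assumes Int_closed: "x \<in> L \<Longrightarrow> y \<in> L \<Longrightarrow> x \<inter> y \<in> L"
    and oc_closed: "x \<in> L \<Longrightarrow> oc x \<in> L"
    and oc_oc: "x \<in> L \<Longrightarrow> oc (oc x) = x"
    and oc_antimono: "x \<in> L \<Longrightarrow> y \<in> L \<Longrightarrow> x \<subseteq> y \<Longrightarrow> oc y \<subseteq> oc x"
    and Int_oc: "x \<in> L \<Longrightarrow> x \<inter> oc x = Z"
    and bot_closed: "Z \<in> L"
begin

definition join :: "'b set \<Rightarrow> 'b set \<Rightarrow> 'b set" where
  "join x y = oc (oc x \<inter> oc y)"

lemma join_closed: "x \<in> L \<Longrightarrow> y \<in> L \<Longrightarrow> join x y \<in> L"
  by (simp add: join_def Int_closed oc_closed)

lemma join_upper1: "x \<in> L \<Longrightarrow> y \<in> L \<Longrightarrow> x \<subseteq> join x y"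
  unfolding join_def by (metis Int_closed Int_lower1 oc_antimono oc_closed oc_oc)

lemma join_comm: "join x y = join y x"
  by (simp add: join_def Int_commute)

lemma join_upper2: "x \<in> L \<Longrightarrow> y \<in> L \<Longrightarrow> y \<subseteq> join x y"
  using join_upper1 join_comm by metis

lemma join_least: "x \<in> L \<Longrightarrow> y \<in> L \<Longrightarrow> z \<in> L \<Longrightarrow> x \<subseteq> z \<Longrightarrow> y \<subseteq> z \<Longrightarrow> join x y \<subseteq> z"
  unfolding join_def by (metis Int_closed Int_greatest oc_antimono oc_closed oc_oc)

lemma oc_join: "x \<in> L \<Longrightarrow> y \<in> L \<Longrightarrow> oc (join x y) = oc x \<inter> oc y"
  by (simp add: join_def Int_closed oc_closed oc_oc)

lemma bot_least: "x \<in> L \<Longrightarrow> Z \<subseteq> x"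
  using Int_oc by blast

lemma top_greatest: "x \<in> L \<Longrightarrow> x \<subseteq> oc Z"
  by (metis bot_closed bot_least oc_antimono oc_closed oc_oc)

lemma join_oc: "x \<in> L \<Longrightarrow> join x (oc x) = oc Z"
  unfolding join_def by (metis Int_oc oc_closed)

lemma join_absorb: "x \<in> L \<Longrightarrow> y \<in> L \<Longrightarrow> y \<subseteq> x \<Longrightarrow> join x y = x"
  by (simp add: join_least join_upper1 subset_antisym)

text \<open>These are the two instances of \<open>p \<and> (q \<or> r) = (p \<and> q) \<or> (p \<and> r)\<close> for \<open>x\<close> and \<open>y\<close> that can fail in an
  ortholattice: all others in \<open>{x, x\<^sup>\<bottom>, y, y\<^sup>\<bottom>}\<close> reduce, up to exchanging the roles of these
  elements, to absorption or idempotency.\<close>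

definition compatible :: "'b set \<Rightarrow> 'b set \<Rightarrow> bool" where
  "compatible x y \<longleftrightarrow> join (x \<inter> y) (x \<inter> oc y) = x \<and> x \<inter> join (oc x) y = x \<inter> y"

lemma meet_distrib_of_compatible:
  assumes s: "s \<in> L" and t: "t \<in> L"
    and comp: "\<And>x y. (x \<in> {s, oc s} \<and> y \<in> {t, oc t}) \<or> (x \<in> {t, oc t} \<and> y \<in> {s, oc s})
      \<Longrightarrow> compatible x y"
    and pqr: "p \<in> {s, oc s, t, oc t}" "q \<in> {s, oc s, t, oc t}" "r \<in> {s, oc s, t, oc t}"
  shows "p \<inter> join q r = join (p \<inter> q) (p \<inter> r)"
proof -
  have L: "x \<in> L" if "x \<in> {s, oc s, t, oc t}" for x using that s t by (auto intro: oc_closed)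
  have pL: "p \<in> L" and qL: "q \<in> L" and rL: "r \<in> L" using L pqr by auto
  note cl = pL qL rL oc_closed Int_closed bot_closed
  have same: ?thesis if "q = r"
    using that cl by (simp add: join_absorb)
  have absorb: ?thesis if "p = q \<or> p = r"
    using that
  proof
    assume "p = q"
    then show ?thesis
      using cl join_upper1[OF qL rL] by (simp add: join_absorb Int_absorb2)
  next
    assume "p = r"
    then show ?thesis
      using cl join_upper2[OF qL rL] by (metis Int_absorb Int_absorb2 Int_lower1 join_absorb join_comm)
  qed
  have complementary: ?thesis if r: "r = oc q" and comp: "compatible p q"
  proof -
    have "p \<inter> join q r = p" unfolding r join_oc[OF qL] using top_greatest[OF pL] by blast
    then show ?thesis using comp unfolding r compatible_def by simp
  qed
  have opposite: "x \<inter> join (oc x) y = join (x \<inter> oc x) (x \<inter> y)"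
    if "x \<in> L" "y \<in> L" "compatible x y" for x y
  proof -
    have "join (x \<inter> oc x) (x \<inter> y) = join (x \<inter> y) Z"
      using that by (metis Int_oc join_comm)
    also have "\<dots> = x \<inter> y"
      using that by (intro join_absorb bot_least Int_closed bot_closed)
    finally show ?thesis using that by (simp add: compatible_def)
  qed
  \<comment> \<open>Each of \<open>p\<close>, \<open>q\<close>, \<open>r\<close> comes from \<open>s\<close> or from \<open>t\<close>; two of the same origin are equal or
    complementary, two of different origins are compatible.\<close>
  define X where "X c = (if c then {s, oc s} else {t, oc t})" for c
  have same_origin: "y = x \<or> y = oc x" if "x \<in> X c" "y \<in> X c" for x y c
    using that s t by (auto simp: X_def oc_oc split: if_splits)
  have diff_origin: "compatible x y" if "x \<in> X c" "y \<in> X d" "c \<noteq> d" for x y c d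
    using that by (intro comp) (auto simp: X_def split: if_splits)
  have "\<exists>c. x \<in> X c" if "x \<in> {s, oc s, t, oc t}" for x
    using that unfolding X_def by (cases "x \<in> {s, oc s}") (auto intro: exI[of _ True] exI[of _ False])
  then obtain a b c where abc: "p \<in> X a" "q \<in> X b" "r \<in> X c" using pqr by meson
  show ?thesis
  proof (cases "b = c")
    case True
    then have qr: "r = q \<or> r = oc q" using same_origin abc by blast
    show ?thesis
    proof (cases "a = b")
      case True
      then have "p = q \<or> p = oc q" using same_origin abc by blast
      then show ?thesis using qr same absorb by metis
    next
      case False
      then have "compatible p q" using diff_origin abc by blast
      then show ?thesis using qr same complementary by metis
    qed
  next
    case False
    then consider "a = b" "a \<noteq> c" | "a = c" "a \<noteq> b" by blast
    then show ?thesis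
    proof cases
      case 1
      then have "compatible p r" "q = p \<or> q = oc p" using diff_origin same_origin abc by blast+
      then show ?thesis using absorb opposite[OF pL rL] by metis
    next
      case 2
      then have "compatible p q" "r = p \<or> r = oc p" using diff_origin same_origin abc by blast+
      then show ?thesis using absorb opposite[OF pL qL] join_comm by metis
    qed
  qed
qed

text \<open>The second distributive law is the first one for the complements, read through \<open>oc\<close>.\<close>

lemma commute_of_compatible:
  assumes s: "s \<in> L" and t: "t \<in> L"
    and comp: "\<And>x y. (x \<in> {s, oc s} \<and> y \<in> {t, oc t}) \<or> (x \<in> {t, oc t} \<and> y \<in> {s, oc s})
      \<Longrightarrow> compatible x y"
  shows "ol_commute (\<inter>) join oc s t"
  unfolding ol_commute_def
proof (intro ballI conjI)
  fix p q r
  assume pqr: "p \<in> {s, oc s, t, oc t}" "q \<in> {s, oc s, t, oc t}" "r \<in> {s, oc s, t, oc t}"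
  show "p \<inter> join q r = join (p \<inter> q) (p \<inter> r)"
    using s t comp pqr by (rule meet_distrib_of_compatible)
  have L: "p \<in> L" "q \<in> L" "r \<in> L" using pqr s t by (auto intro: oc_closed)
  have "oc x \<in> {s, oc s, t, oc t}" if "x \<in> {s, oc s, t, oc t}" for x
    using that oc_oc[OF s] oc_oc[OF t] by (elim insertE emptyE) simp_all
  note oc_pqr = pqr[THEN this]
  have "oc p \<inter> join (oc q) (oc r) = join (oc p \<inter> oc q) (oc p \<inter> oc r)"
    using s t comp oc_pqr by (rule meet_distrib_of_compatible)
  then have "oc (oc p \<inter> join (oc q) (oc r)) = oc (join (oc p \<inter> oc q) (oc p \<inter> oc r))"
    by simp
  then show "join p (q \<inter> r) = join p q \<inter> join p r"
    using L by (simp add: oc_join Int_closed oc_closed join_closed oc_oc) (simp add: join_def oc_oc)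
qed

text \<open>If \<open>s\<close> splits \<open>x\<^sup>\<bottom>\<close>, complementation gives \<open>(s \<or> x) \<and> (s\<^sup>\<bottom> \<or> x) = x\<close>, whence
  \<open>s\<^sup>\<bottom> \<and> (s \<or> x) = s\<^sup>\<bottom> \<and> x\<close>.  This weak modularity supplies the remaining instances of
  distributivity, including those in which the roles of \<open>s\<close> and \<open>x\<close> are exchanged.\<close>

lemma central_iff_splits:
  assumes s: "s \<in> L"
  shows "s \<in> ol_center L (\<inter>) join oc \<longleftrightarrow> (\<forall>x\<in>L. x \<subseteq> join (x \<inter> s) (x \<inter> oc s))"
proof
  assume "s \<in> ol_center L (\<inter>) join oc"
  then have "x \<inter> join s (oc s) = join (x \<inter> s) (x \<inter> oc s)" if "x \<in> L" for x
    using that by (simp add: ol_center_def ol_commute_def)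
  then have "x \<inter> oc Z = join (x \<inter> s) (x \<inter> oc s)" if "x \<in> L" for x
    using that s by (simp add: join_oc)
  then show "\<forall>x\<in>L. x \<subseteq> join (x \<inter> s) (x \<inter> oc s)"
    using top_greatest by (metis Int_absorb2 order_refl)
next
  assume split: "\<forall>x\<in>L. x \<subseteq> join (x \<inter> s) (x \<inter> oc s)"
  have split_eq: "join (x \<inter> z) (x \<inter> oc z) = x" if "x \<in> L" "z \<in> {s, oc s}" for x z
  proof -
    have "join (x \<inter> s) (x \<inter> oc s) = x"
      using that(1) s split join_least[of "x \<inter> s" "x \<inter> oc s" x]
      by (simp add: Int_closed oc_closed subset_antisym)
    then show ?thesis using that(2) oc_oc[OF s] join_comm[of "x \<inter> oc s"] by auto
  qed
  \<comment> \<open>The splitting of \<open>oc x\<close>, read through the orthocomplement.\<close>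
  have disj: "oc z \<inter> join z x = oc z \<inter> x" if "x \<in> L" "z \<in> {s, oc s}" for x z
  proof -
    have z: "z \<in> L" using that s oc_closed by auto
    have "oc (join (oc x \<inter> z) (oc x \<inter> oc z)) = oc (oc x)"
      using split_eq[OF oc_closed[OF that(1)] that(2)] by simp
    then have "join z x \<inter> join (oc z) x = x"
      using that(1) z
      by (simp add: oc_join Int_closed oc_closed oc_oc)
        (simp add: join_def oc_oc Int_commute)
    then show ?thesis
      using join_upper1[OF oc_closed[OF z] that(1)] join_upper2[OF z that(1)] by blast
  qed
  have z_y: "compatible z y" if zs: "z \<in> {s, oc s}" and y: "y \<in> L" for z y
  proof -
    have z: "z \<in> L" and z': "oc z \<in> {s, oc s}" using zs s oc_closed oc_oc by auto
    have L: "oc y \<in> L" "oc z \<in> L" "z \<inter> y \<in> L" "z \<inter> oc y \<in> L"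
      using y z by (simp_all add: oc_closed Int_closed)
    define j where "j = join (z \<inter> y) (z \<inter> oc y)"
    have j: "j \<in> L" and j': "join (oc z) j \<in> L"
      unfolding j_def using L by (simp_all add: join_closed)
    have j_upper: "z \<inter> y \<subseteq> j" "z \<inter> oc y \<subseteq> j"
      unfolding j_def using L by (simp_all add: join_upper1 join_upper2)
    have disj_z: "z \<inter> join (oc z) x = z \<inter> x" if "x \<in> L" for x
      using disj[OF that z'] by (simp add: oc_oc[OF z])
    \<comment> \<open>\<open>oc z\<close> and \<open>j\<close> together dominate both \<open>y\<close> and \<open>oc y\<close>, hence everything.\<close>
    have below: "u \<subseteq> join (oc z) j" if u: "u \<in> L" "u \<inter> z \<subseteq> j" for u
    proof -
      have "join (u \<inter> z) (u \<inter> oc z) \<subseteq> join (oc z) j"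
        using join_upper1[OF L(2) j] join_upper2[OF L(2) j] u
        by (intro join_least Int_closed j' z L(2)) auto
      then show ?thesis by (simp only: split_eq[OF u(1) zs])
    qed
    have "y \<subseteq> join (oc z) j" "oc y \<subseteq> join (oc z) j"
      using below[OF y] below[OF L(1)] j_upper by (simp_all add: Int_commute)
    then have "join y (oc y) \<subseteq> join (oc z) j" by (intro join_least y L(1) j')
    then have "z \<subseteq> z \<inter> join (oc z) j"
      using top_greatest[OF z] unfolding join_oc[OF y] by blast
    then have "z \<subseteq> j" unfolding disj_z[OF j] by blast
    moreover have "j \<subseteq> z" unfolding j_def by (intro join_least L z Int_lower1)
    ultimately show ?thesis
      using disj_z[OF y] by (simp add: compatible_def j_def)
  qed
  have y_z: "compatible y z" if zs: "z \<in> {s, oc s}" and y: "y \<in> L" for z y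
  proof -
    have z: "z \<in> L" using zs s oc_closed by auto
    have L: "oc y \<in> L" "oc z \<in> L" "y \<inter> z \<in> L" using y z by (simp_all add: oc_closed Int_closed)
    define w where "w = y \<inter> join (oc y) z"
    have w: "w \<in> L" unfolding w_def using y z L by (simp add: Int_closed join_closed)
    have "w \<inter> oc z \<subseteq> y \<inter> oc y"
      using disj[OF L(1) zs] unfolding w_def join_comm[of "oc y"] by blast
    then have "w \<inter> oc z \<subseteq> y \<inter> z" using Int_oc[OF y] bot_least[OF L(3)] by blast
    moreover have "w \<inter> z \<subseteq> y \<inter> z" unfolding w_def by blast
    ultimately have "join (w \<inter> z) (w \<inter> oc z) \<subseteq> y \<inter> z"
      by (intro join_least Int_closed w y z L(2))
    then have "w \<subseteq> y \<inter> z" by (simp only: split_eq[OF w zs])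
    then have "w = y \<inter> z" using join_upper2[OF L(1) z] unfolding w_def by blast
    then show ?thesis using split_eq[OF y zs] by (simp add: compatible_def w_def)
  qed
  have "ol_commute (\<inter>) join oc s t" if t: "t \<in> L" for t
  proof (rule commute_of_compatible[OF s t])
    fix x y assume xy: "x \<in> {s, oc s} \<and> y \<in> {t, oc t} \<or> x \<in> {t, oc t} \<and> y \<in> {s, oc s}"
    have t': "u \<in> L" if "u \<in> {t, oc t}" for u using that t oc_closed[OF t] by auto
    from xy show "compatible x y"
    proof
      assume "x \<in> {s, oc s} \<and> y \<in> {t, oc t}"
      then show ?thesis by (intro z_y t') simp_all
    next
      assume "x \<in> {t, oc t} \<and> y \<in> {s, oc s}"
      then show ?thesis by (intro y_z t') simp_all
    qed
  qed
  then show "s \<in> ol_center L (\<inter>) join oc" using s by (simp add: ol_center_def)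
qed

end

section \<open>The ortholattice of annihilators\<close>

lemma perp_in_subset: "perp_in B S \<subseteq> B"
  by (auto simp: perp_in_def)

lemma perp_in_antimono: "S \<subseteq> T \<Longrightarrow> perp_in B T \<subseteq> perp_in B S"
  by (auto simp: perp_in_def)

lemma perp_in_Un: "perp_in B (S \<union> T) = perp_in B S \<inter> perp_in B T"
  by (auto simp: perp_in_def)

lemma perp_inI:
  assumes "b \<in> B" "\<And>s. s \<in> S \<Longrightarrow> s * b = 0" "\<And>s. s \<in> S \<Longrightarrow> s * star b = 0"
  shows "b \<in> perp_in B S"
  using assms by (simp add: perp_in_def cperp_def)

lemma perp_inD:
  assumes "b \<in> perp_in B S"
  shows "b \<in> B" "s \<in> S \<Longrightarrow> s * b = 0" "s \<in> S \<Longrightarrow> s * star b = 0"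
  using assms by (simp_all add: perp_in_def cperp_def)

lemma perp_in_star:
  assumes "cstar_subalgebra B" "b \<in> perp_in B S"
  shows "star b \<in> perp_in B S"
  using assms by (auto simp: perp_in_def cperp_def star_star subalgebraD)

lemma perp_in_compress:
  assumes "cstar_subalgebra B" "c \<in> perp_in B S" "b \<in> B" "d \<in> perp_in B S"
  shows "c * b * d \<in> perp_in B S"
proof (rule perp_inI)
  show "c * b * d \<in> B" using assms perp_in_subset by (metis subalgebra_mult subsetD)
  fix s assume s: "s \<in> S"
  show "s * (c * b * d) = 0"
    using perp_inD(2)[OF assms(2) s] by (simp flip: mult.assoc)
  show "s * star (c * b * d) = 0"
    using perp_inD(3)[OF assms(4) s] by (simp add: star_mult flip: mult.assoc)
qed

lemma subset_perp_perp:
  assumes "T \<subseteq> B" and star: "\<And>x. x \<in> T \<Longrightarrow> star x \<in> T"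
  shows "T \<subseteq> perp_in B (perp_in B T)"
proof
  fix x assume x: "x \<in> T"
  show "x \<in> perp_in B (perp_in B T)"
  proof (rule perp_inI)
    fix s assume s: "s \<in> perp_in B T"
    have "star (star x * star s) = 0" "star (x * star s) = 0"
      using perp_inD(3)[OF s] x star by simp_all
    then show "s * x = 0" "s * star x = 0" by (simp_all only: star_mult star_star)
  qed (use x assms in auto)
qed

text \<open>The relation \<open>\<bottom>\<close> is not symmetric: \<open>S \<subseteq> S\<^sup>\<bottom>\<^sup>\<bottom>\<close> may fail unless \<open>S\<close> is self-adjoint.  Since \<open>s b = 0\<close> iff \<open>s\<^sup>* s b = 0\<close>,
  a set may be replaced by the positive elements \<open>s\<^sup>* s\<close> without changing its annihilator.\<close>

lemma perp_in_positive: "perp_in B ((\<lambda>s. star s * s) ` S) = perp_in B S"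
  by (auto simp: perp_in_def cperp_def star_mult_self_cancel)

lemma perp_perp_perp:
  assumes B: "cstar_subalgebra B" and S: "S \<subseteq> B"
  shows "perp_in B (perp_in B (perp_in B S)) = perp_in B S"
proof
  show "perp_in B S \<subseteq> perp_in B (perp_in B (perp_in B S))"
    by (rule subset_perp_perp) (auto simp: perp_in_subset perp_in_star[OF B])
  let ?T = "(\<lambda>s. star s * s) ` S"
  have "?T \<subseteq> perp_in B (perp_in B ?T)"
    by (rule subset_perp_perp) (use S B in \<open>auto simp: subalgebraD star_mult star_star\<close>)
  then have "perp_in B (perp_in B (perp_in B ?T)) \<subseteq> perp_in B ?T"
    by (rule perp_in_antimono)
  then show "perp_in B (perp_in B (perp_in B S)) \<subseteq> perp_in B S"
    by (simp only: perp_in_positive)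
qed

lemma annihilator_subset: "C \<in> annihilators B \<Longrightarrow> C \<subseteq> B"
  by (auto simp: annihilators_def perp_in_def)

lemma perp_in_annihilator: "S \<subseteq> B \<Longrightarrow> perp_in B S \<in> annihilators B"
  by (auto simp: annihilators_def)

lemma perp_perp_annihilator:
  "cstar_subalgebra B \<Longrightarrow> C \<in> annihilators B \<Longrightarrow> perp_in B (perp_in B C) = C"
  by (auto simp: annihilators_def perp_perp_perp)

lemma annihilator_star:
  "cstar_subalgebra B \<Longrightarrow> C \<in> annihilators B \<Longrightarrow> c \<in> C \<Longrightarrow> star c \<in> C"
  by (auto simp: annihilators_def perp_in_star)

lemma annihilator_compress:
  "cstar_subalgebra B \<Longrightarrow> C \<in> annihilators B \<Longrightarrow> c \<in> C \<Longrightarrow> b \<in> B \<Longrightarrow> d \<in> C \<Longrightarrow> c * b * d \<in> C"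
  by (auto simp: annihilators_def perp_in_compress)

lemma perp_in_orthogonal:
  assumes "cstar_subalgebra B" "C \<in> annihilators B" "x \<in> perp_in B C" "c \<in> C"
  shows "x * c = 0" "c * x = 0"
proof -
  show "c * x = 0" using perp_inD(2)[OF assms(3,4)] .
  have "star c * star x = 0" using perp_inD(3)[OF assms(3)] annihilator_star[OF assms(1,2,4)] .
  then have "star (star c * star x) = 0" by simp
  then show "x * c = 0" by (simp only: star_mult star_star)
qed

lemma Int_perp_in:
  assumes B: "cstar_subalgebra B" and C: "C \<in> annihilators B"
  shows "C \<inter> perp_in B C = {0}"
proof -
  have "x = 0" if "x \<in> C" "x \<in> perp_in B C" for x
    using perp_inD(3)[OF that(2,1)] by simp
  moreover have "0 \<in> C" using C B by (auto simp: annihilators_def perp_in_def cperp_def subalgebraD)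
  moreover have "0 \<in> perp_in B C" using B by (auto simp: perp_in_def cperp_def subalgebraD)
  ultimately show ?thesis by blast
qed

lemma set_ortholattice_annihilators:
  assumes B: "cstar_subalgebra B"
  shows "set_ortholattice (annihilators B) (perp_in B) {0}"
proof
  fix C D assume C: "C \<in> annihilators B" and D: "D \<in> annihilators B"
  from C obtain S where "C = perp_in B S" "S \<subseteq> B" by (auto simp: annihilators_def)
  moreover from D obtain T where "D = perp_in B T" "T \<subseteq> B" by (auto simp: annihilators_def)
  ultimately show "C \<inter> D \<in> annihilators B"
    using perp_in_annihilator[of "S \<union> T" B] by (simp add: perp_in_Un)
next
  have "perp_in B B \<in> annihilators B" "perp_in B {} \<in> annihilators B"
    by (simp_all add: perp_in_annihilator)
  moreover have "perp_in B {} = B" by (simp add: perp_in_def)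
  ultimately show "{0} \<in> annihilators B"
    using Int_perp_in[OF B, of B] perp_in_subset[of B B] by (simp add: Int_absorb1)
qed (simp_all add: assms perp_in_annihilator annihilator_subset perp_perp_annihilator
    perp_in_antimono Int_perp_in)

lemma central_annihilators_iff_splits:
  assumes B: "cstar_subalgebra B"
  shows "C \<in> central_annihilators B \<longleftrightarrow> C \<in> annihilators B \<and>
    (\<forall>D\<in>annihilators B. D \<subseteq> perp_in B (perp_in B (D \<inter> C) \<inter> perp_in B (D \<inter> perp_in B C)))"
proof -
  interpret set_ortholattice "annihilators B" "perp_in B" "{0}"
    by (rule set_ortholattice_annihilators[OF B])
  have join: "join_in B = join"
    by (simp add: fun_eq_iff join_in_def join_def perp_in_Un)
  have "C \<in> annihilators B" if "C \<in> central_annihilators B"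
    using that by (simp add: central_annihilators_def ol_center_def)
  then show ?thesis
    unfolding central_annihilators_def join using central_iff_splits[of C]
    by (auto simp only: join_def)
qed

section \<open>Central annihilators are the annihilator ideals\<close>

text \<open>Let \<open>x\<close> be orthogonal to \<open>D \<inter> C\<close> and \<open>D \<inter> C\<^sup>\<bottom>\<close>, and \<open>d \<in> D\<close>.  Since \<open>d C d\<^sup>* \<subseteq> D \<inter> C\<close>, the product
  \<open>x d\<close> kills \<open>C\<close>, and likewise \<open>C\<^sup>\<bottom>\<close>.  Then \<open>(x d)\<^sup>* (x d)\<close> lies in \<open>C\<^sup>\<bottom>\<close> and is killed by itself.\<close>

lemma splits_of_ideal:
  fixes B :: "'a::cstar_algebra set"
  assumes B: "cstar_subalgebra B" and C: "C \<in> annihilators B" and D: "D \<in> annihilators B"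
    and ideal: "\<And>c b c'. c \<in> C \<Longrightarrow> b \<in> B \<Longrightarrow> c' \<in> perp_in B C \<Longrightarrow> c * b * c' = 0"
  shows "D \<subseteq> perp_in B (perp_in B (D \<inter> C) \<inter> perp_in B (D \<inter> perp_in B C))"
proof
  let ?P = "perp_in B C"
  have CB: "C \<subseteq> B" and DB: "D \<subseteq> B" using C D by (simp_all add: annihilator_subset)
  have P: "?P \<in> annihilators B" using CB by (rule perp_in_annihilator)
  have PP: "perp_in B ?P = C" using B C by (rule perp_perp_annihilator)
  have ideal': "c' * b * c = 0" if "c \<in> C" "b \<in> B" "c' \<in> ?P" for c b c'
    using ideal[OF annihilator_star[OF B C that(1)] subalgebra_star[OF B that(2)]
        perp_in_star[OF B that(3)]]
    by (simp only: star_mult_mult_eq_0_iff)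
  have xd: "x * d = 0"
    if x: "x \<in> perp_in B (D \<inter> C) \<inter> perp_in B (D \<inter> ?P)" and d: "d \<in> D" for x d
  proof -
    have xB: "x \<in> B" and dB: "d \<in> B" using x d DB perp_inD(1) by auto
    \<comment> \<open>For an ideal \<open>E\<close>, the compression \<open>d E d\<^sup>*\<close> lies in \<open>D \<inter> E\<close>.\<close>
    have kill: "x * d * c = 0"
      if E: "E \<in> annihilators B" and xE: "x \<in> perp_in B (D \<inter> E)" and c: "c \<in> E"
        and id: "\<And>y b. y \<in> perp_in B E \<Longrightarrow> b \<in> B \<Longrightarrow> y * b * c = 0" for E c
    proof -
      have cB: "c \<in> B" using E c annihilator_subset by blast
      let ?z = "d * (c * star c) * star d"
      have star_z: "star ?z = ?z" by (simp add: star_mult star_star mult.assoc)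
      have "?z \<in> D"
        using B D d cB by (intro annihilator_compress) (auto simp: annihilator_star subalgebraD)
      moreover have "?z \<in> perp_in B (perp_in B E)"
      proof (rule perp_inI)
        show "?z \<in> B" using B dB cB by (simp add: subalgebraD)
        fix y assume y: "y \<in> perp_in B E"
        have "y * ?z = y * d * c * star c * star d" by (simp add: mult.assoc)
        then show yz: "y * ?z = 0" using id[OF y dB] by simp
        then show "y * star ?z = 0" by (simp only: star_z)
      qed
      ultimately have "?z \<in> D \<inter> E" using B E by (simp add: perp_perp_annihilator)
      then have "?z * star x = 0" using perp_inD(3)[OF xE] by blast
      then have "star (?z * star x) = 0" by simp
      then have "x * ?z = 0" unfolding star_mult[of ?z] star_z star_star .
      then have "(x * d) * (c * star c) * star d * star x = 0"
        by (simp add: mult.assoc)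
      then have "(x * d * c) * star (x * d * c) = 0"
        by (simp add: star_mult mult.assoc)
      then show ?thesis by (simp only: mult_star_self_eq_0_iff)
    qed
    have kill_C: "x * d * c = 0" if "c \<in> C" for c
      using kill[OF C _ that] x ideal' that by blast
    have kill_P: "x * d * c = 0" if "c \<in> ?P" for c
      using kill[OF P _ that] x ideal that PP by blast
    let ?p = "star (x * d) * (x * d)"
    have star_p: "star ?p = ?p" by (simp add: star_mult star_star)
    have "?p \<in> ?P"
    proof (rule perp_inI)
      show "?p \<in> B" using B xB dB by (simp add: subalgebraD)
      fix c assume "c \<in> C"
      then have "?p * star c = 0"
        using kill_C[of "star c"] annihilator_star[OF B C] by (simp add: mult.assoc)
      then have "star (?p * star c) = 0" by simp
      then show cp: "c * ?p = 0" unfolding star_mult[of ?p] star_p star_star .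
      then show "c * star ?p = 0" unfolding star_p .
    qed
    then have "x * d * ?p = 0" by (rule kill_P)
    then have "?p * star ?p = 0" unfolding star_p by (simp add: mult.assoc)
    then show ?thesis by (simp only: mult_star_self_eq_0_iff star_mult_self_eq_0_iff)
  qed
  fix d assume d: "d \<in> D"
  show "d \<in> perp_in B (perp_in B (D \<inter> C) \<inter> perp_in B (D \<inter> ?P))"
    using d DB xd annihilator_star[OF B D] by (intro perp_inI) auto
qed

text \<open>Suppose \<open>w = c b c'\<close> with \<open>c \<in> C\<close> and \<open>c' \<in> C\<^sup>\<bottom>\<close>.  Viewing \<open>w\<close> as an operator from the
  support of \<open>C\<^sup>\<bottom>\<close> to that of \<open>C\<close>, the annihilator \<open>D\<close> generated by \<open>t = (1 + w) w\<^sup>*\<close> lives on the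
  graph of \<open>w\<close>, which is in general position to both supports; so \<open>D\<close> meets \<open>C\<close> and \<open>C\<^sup>\<bottom>\<close> only
  in \<open>0\<close>.  Splitting forces \<open>D = 0\<close>, whence \<open>w = 0\<close>.\<close>

lemma ideal_of_splits:
  fixes B :: "'a::cstar_algebra set"
  assumes B: "cstar_subalgebra B" and C: "C \<in> annihilators B"
    and split: "\<And>D. D \<in> annihilators B \<Longrightarrow>
      D \<subseteq> perp_in B (perp_in B (D \<inter> C) \<inter> perp_in B (D \<inter> perp_in B C))"
    and c: "c \<in> C" and b: "b \<in> B" and c': "c' \<in> perp_in B C"
  shows "c * b * c' = 0"
proof -
  let ?P = "perp_in B C"
  have CB: "C \<subseteq> B" using C by (rule annihilator_subset)
  have P: "?P \<in> annihilators B" using CB by (rule perp_in_annihilator)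
  note orth = perp_in_orthogonal[OF B C]
  define w where "w = c * b * c'"
  define t where "t = star w + w * star w"
  have wB: "w \<in> B" using B c b c' CB perp_in_subset[of B C] unfolding w_def
    by (meson subalgebra_mult subsetD)
  have tB: "t \<in> B" unfolding t_def using B wB by (simp add: subalgebraD)
  have w_C: "w * x = 0" if "x \<in> C" for x
    unfolding w_def using orth(1)[OF c' that] by (simp add: mult.assoc)
  have P_w: "x * w = 0" if "x \<in> ?P" for x
    unfolding w_def using orth(1)[OF that c] by (simp flip: mult.assoc)
  have C_star_w: "x * star w = 0" if "x \<in> C" for x
    using w_C[OF annihilator_star[OF B C that]] star_mult[of w "star x"] by (simp add: star_star)
  have ww: "w * w = 0"
    unfolding w_def using orth(1)[OF c' c] by (metis mult.assoc mult_zero_left mult_zero_right)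
  define T where "T = perp_in B {t * star t}"
  define D where "D = perp_in B T"
  have ttB: "t * star t \<in> B" using tB B by (simp add: subalgebraD)
  have D: "D \<in> annihilators B" unfolding D_def T_def by (simp add: perp_in_annihilator perp_in_subset)
  have tD: "t * star t \<in> D"
    using subset_perp_perp[of "{t * star t}" B] ttB unfolding D_def T_def
    by (simp add: star_mult star_star)
  have D_kill: "s * x = 0" if "s \<in> B" "s * t = 0" "x \<in> D" for s x
  proof -
    have star_ss: "star (star s * s) = star s * s" by (simp add: star_mult star_star)
    have "t * star t * (star s * s) = t * star (s * t) * s" by (simp add: star_mult mult.assoc)
    then have "t * star t * (star s * s) = 0" using that(2) by simp
    then have "star s * s \<in> T"
      unfolding T_def using B that(1) by (intro perp_inI) (auto simp: subalgebraD star_ss)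
    then have "star s * s * x = 0" using that(3) unfolding D_def by (rule perp_inD(2)[rotated])
    then show ?thesis by (simp only: star_mult_self_cancel)
  qed
  \<comment> \<open>The elements \<open>y - y w\<close> with \<open>y \<in> C\<close> vanish on the graph.\<close>
  have graph_kill: "y * x = y * w * x" if "y \<in> C" "x \<in> D" for x y
  proof -
    have "y \<in> B" using that(1) CB by blast
    then have yB: "y - y * w \<in> B" using B wB by (simp add: subalgebraD)
    have "(y - y * w) * t = 0"
      unfolding t_def using C_star_w[OF that(1)] ww
      by (simp add: algebra_simps) (simp flip: mult.assoc)
    then have "(y - y * w) * x = 0"
      using D_kill[OF yB _ that(2)] by blast
    then show ?thesis by (simp add: left_diff_distrib)
  qed
  have DC: "x = 0" if "x \<in> D" "x \<in> C" for x
    using graph_kill[OF annihilator_star[OF B C that(2)] that(1)] w_C[OF that(2)]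
    by (simp add: mult.assoc)
  have DP: "x = 0" if xD: "x \<in> D" and xP: "x \<in> ?P" for x
  proof -
    have xB: "x \<in> B" using xP by (rule perp_inD(1))
    let ?y = "(w * x) * star (w * x)"
    have "c * (b * c' * x * star x * star c' * star b) * star c \<in> C"
    proof (rule annihilator_compress[OF B C c])
      show "b * c' * x * star x * star c' * star b \<in> B"
        using b perp_inD(1)[OF c'] xB B by (simp add: subalgebraD)
    qed (rule annihilator_star[OF B C c])
    then have y: "?y \<in> C" by (simp add: w_def star_mult mult.assoc)
    have "?y * (w * x) = 0"
      using graph_kill[OF y xD] orth(2)[OF xP y] by (simp add: mult.assoc)
    then have "star (star (w * x)) * star (w * x) * (w * x) = 0" by (simp only: star_star)
    then have wx: "w * x = 0"
      by (simp only: star_mult_self_cancel star_mult_self_eq_0_iff)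
    have "star x * star w = 0" using arg_cong[OF wx, of star] by (simp add: star_mult)
    moreover have "star x * w = 0" using P_w perp_in_star[OF B xP] by blast
    ultimately have "star x * t = 0" unfolding t_def by (simp add: distrib_left flip: mult.assoc)
    then have "star x * x = 0" using D_kill[of "star x" x] xB xD B by (simp add: subalgebraD)
    then show ?thesis by simp
  qed
  have "D \<inter> C \<subseteq> {0}" "D \<inter> ?P \<subseteq> {0}" using DC DP by blast+
  then have "perp_in B {0} \<subseteq> perp_in B (D \<inter> C) \<inter> perp_in B (D \<inter> ?P)"
    by (simp add: perp_in_antimono)
  moreover have "perp_in B {0} = B" by (auto simp: perp_in_def cperp_def)
  ultimately have "perp_in B (perp_in B (D \<inter> C) \<inter> perp_in B (D \<inter> ?P)) \<subseteq> perp_in B B"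
    by (intro perp_in_antimono) simp
  then have "t * star t \<in> perp_in B B" using split[OF D] tD by blast
  then have "(t * star t) * star (t * star t) = 0" using ttB by (rule perp_inD(3))
  then have "t = 0" by (simp only: mult_star_self_eq_0_iff)
  then have "w * t = 0" by simp
  then have "w * star w = 0" unfolding t_def using ww by (simp add: distrib_left flip: mult.assoc)
  then have "w = 0" by simp
  then show ?thesis by (simp add: w_def)
qed

text \<open>The condition \<open>C B C\<^sup>\<bottom> = 0\<close> says that \<open>C = C\<^sup>\<bottom>\<^sup>\<bottom>\<close> contains \<open>B C\<close> and \<open>C B\<close>.\<close>

theorem central_annihilators_iff_ideal:
  fixes B :: "'a::cstar_algebra set"
  assumes B: "cstar_subalgebra B"
  shows "C \<in> central_annihilators B \<longleftrightarrow>
    C \<in> annihilators B \<and> (\<forall>c\<in>C. \<forall>b\<in>B. \<forall>c'\<in>perp_in B C. c * b * c' = 0)"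
  unfolding central_annihilators_iff_splits[OF B]
proof (intro conj_cong refl iffI ballI)
  fix D
  assume "C \<in> annihilators B" "D \<in> annihilators B"
    and "\<forall>c\<in>C. \<forall>b\<in>B. \<forall>c'\<in>perp_in B C. c * b * c' = 0"
  then show "D \<subseteq> perp_in B (perp_in B (D \<inter> C) \<inter> perp_in B (D \<inter> perp_in B C))"
    by (intro splits_of_ideal[OF B]) simp_all
next
  fix c b c'
  assume "C \<in> annihilators B" "c \<in> C" "b \<in> B" "c' \<in> perp_in B C"
    and "\<forall>D\<in>annihilators B.
      D \<subseteq> perp_in B (perp_in B (D \<inter> C) \<inter> perp_in B (D \<inter> perp_in B C))"
  then show "c * b * c' = 0"
    by (intro ideal_of_splits[OF B]) simp_all
qed

section \<open>Restriction to and extension from a hereditary subalgebra\<close>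

text \<open>If \<open>x \<in> B\<close> is orthogonal to \<open>B \<inter> D\<close> and \<open>y \<in> D\<close>, then \<open>x\<^sup>* y\<^sup>* y x\<close> lies in the ideal \<open>D\<close>, and
  in \<open>B\<close> by heredity; so \<open>x\<close> is orthogonal to it, which gives \<open>y x = 0\<close>.\<close>

lemma perp_in_restrict_ideal:
  fixes B D :: "'a::cstar_algebra set"
  assumes B: "hereditary_cstar_subalgebra B" and D: "D \<in> annihilators UNIV"
    and ideal: "\<And>d a c. d \<in> D \<Longrightarrow> c \<in> perp_in UNIV D \<Longrightarrow> c * a * d = 0"
  shows "perp_in B (B \<inter> D) = B \<inter> perp_in UNIV D"
proof
  note U = cstar_subalgebra_UNIV
  have sub: "cstar_subalgebra B" using B by (simp add: hereditary_cstar_subalgebra_def)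
  show "B \<inter> perp_in UNIV D \<subseteq> perp_in B (B \<inter> D)" by (auto simp: perp_in_def)
  have kill: "y * x = 0" if x: "x \<in> perp_in B (B \<inter> D)" and y: "y \<in> D" for x y
  proof -
    have xB: "x \<in> B" using x by (rule perp_inD(1))
    let ?z = "star (y * x) * (y * x)"
    have star_z: "star ?z = ?z" by (simp add: star_mult star_star)
    have "?z \<in> B" using hereditary_compress_positive[OF B xB] .
    moreover have "?z \<in> perp_in UNIV (perp_in UNIV D)"
    proof (rule perp_inI)
      fix s assume s: "s \<in> perp_in UNIV D"
      have "s * ?z = s * star x * star y * y * x" by (simp add: star_mult mult.assoc)
      then show "s * ?z = 0" using ideal[OF annihilator_star[OF U D y] s] by simp
      then show "s * star ?z = 0" by (simp only: star_z)
    qed simp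
    ultimately have "?z \<in> B \<inter> D" using perp_perp_annihilator[OF U D] by simp
    then have "?z * star x = 0" by (rule perp_inD(3)[OF x])
    then have "y * x * star x = 0"
      by (simp only: star_mult_self_cancel)
    then show ?thesis by (simp only: mult.assoc mult_star_self_cancel)
  qed
  show "perp_in B (B \<inter> D) \<subseteq> B \<inter> perp_in UNIV D"
    using kill perp_in_star[OF sub] perp_inD(1) by (auto intro!: perp_inI)
qed

lemma central_restrict:
  fixes B :: "'a::cstar_algebra set"
  assumes B: "hereditary_cstar_subalgebra B" and C: "C \<in> central_annihilators UNIV"
  shows "B \<inter> C \<in> central_annihilators B"
proof -
  note U = cstar_subalgebra_UNIV
  have sub: "cstar_subalgebra B" using B by (simp add: hereditary_cstar_subalgebra_def)
  let ?P = "perp_in UNIV C"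
  have ann: "C \<in> annihilators UNIV" "?P \<in> annihilators UNIV"
    and ideal: "\<And>c a c'. c \<in> C \<Longrightarrow> c' \<in> ?P \<Longrightarrow> c * a * c' = 0"
    using C by (auto simp: central_annihilators_iff_ideal[OF U] perp_in_annihilator)
  have PP: "perp_in UNIV ?P = C" using U ann(1) by (rule perp_perp_annihilator)
  have ideal': "c' * a * c = 0" if "c \<in> C" "c' \<in> ?P" for c a c'
    using ideal[OF annihilator_star[OF U ann(1) that(1)] perp_in_star[OF U that(2)], of "star a"]
    by (simp only: star_mult_mult_eq_0_iff)
  have "perp_in B (B \<inter> ?P) = B \<inter> C"
    using perp_in_restrict_ideal[OF B ann(2)] ideal PP by simp
  then have "B \<inter> C \<in> annihilators B" using perp_in_annihilator[of "B \<inter> ?P" B] by simp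
  moreover have "perp_in B (B \<inter> C) = B \<inter> ?P"
    using perp_in_restrict_ideal[OF B ann(1)] ideal' by simp
  ultimately show ?thesis
    using ideal by (simp add: central_annihilators_iff_ideal[OF sub])
qed

text \<open>The extension of \<open>E\<close> is the annihilator of the ideal of \<open>A\<close> generated by \<open>F = E\<^sup>\<bottom>\<close>.\<close>

lemma central_extend:
  fixes B :: "'a::cstar_algebra set"
  assumes B: "hereditary_cstar_subalgebra B" and E: "E \<in> central_annihilators B"
  shows "\<exists>C \<in> central_annihilators UNIV. E = B \<inter> C"
proof -
  note U = cstar_subalgebra_UNIV
  have sub: "cstar_subalgebra B" using B by (simp add: hereditary_cstar_subalgebra_def)
  let ?F = "perp_in B E"
  have ann: "E \<in> annihilators B"
    and ideal: "\<And>e b f. e \<in> E \<Longrightarrow> b \<in> B \<Longrightarrow> f \<in> ?F \<Longrightarrow> e * b * f = 0"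
    using E by (auto simp: central_annihilators_iff_ideal[OF sub])
  have EB: "E \<subseteq> B" using ann by (rule annihilator_subset)
  \<comment> \<open>Heredity moves the middle factor from \<open>A\<close> into \<open>B\<close>.\<close>
  have EAF_star: "e * a * star f = 0" if e: "e \<in> E" and f: "f \<in> ?F" for e a f
  proof -
    have eB: "star e \<in> B" "e \<in> B" and fB: "f \<in> B" "star f \<in> B"
      using e f EB perp_inD(1)[OF f] sub by (auto simp: subalgebraD)
    have "star (star a * star e) * (star f * f) \<in> B"
      by (rule hereditary_compress[OF B eB(1) fB(1)])
    then have "star e * (star (star a * star e) * (star f * f)) * star f = 0"
      using annihilator_star[OF sub ann e] perp_in_star[OF sub f] by (intro ideal)
    then have "star e * e * (a * (star f * f) * star f) = 0"
      by (simp add: star_mult star_star mult.assoc)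
    then have "e * (a * (star f * f) * star f) = 0"
      by (simp only: star_mult_self_cancel)
    then have "e * a * star f * (f * star f) = 0" by (simp add: mult.assoc)
    then have "e * a * star f * f = 0" by (simp only: mult_star_self_cancel)
    then have "e * a * (star f * star (star f)) = 0" by (simp add: star_star mult.assoc)
    then show ?thesis by (simp only: mult_star_self_cancel)
  qed
  have EAF: "e * a * f = 0" if "e \<in> E" "f \<in> ?F" for e a f
    using EAF_star[OF that(1) perp_in_star[OF sub that(2)]] by (simp add: star_star)
  have FAE: "f * a * e = 0" if "e \<in> E" "f \<in> ?F" for e a f
    using EAF_star[OF annihilator_star[OF sub ann that(1)] that(2), of "star a"]
    by (simp only: star_mult_mult_eq_0_iff)
  define G where "G = {a * f * b | a f b. f \<in> ?F}"
  define C where "C = perp_in UNIV G"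
  have C: "C \<in> annihilators UNIV" unfolding C_def by (simp add: perp_in_annihilator)
  have G_right: "g * x \<in> G" if g: "g \<in> G" for g x
  proof -
    obtain a f b where "g = a * f * b" "f \<in> ?F" using g unfolding G_def by blast
    then have "g * x = a * f * (b * x)" by (simp add: mult.assoc)
    with \<open>f \<in> ?F\<close> show ?thesis unfolding G_def by blast
  qed
  have C_right: "c * a \<in> C" if c: "c \<in> C" for c a
    unfolding C_def
  proof (rule perp_inI)
    fix g assume g: "g \<in> G"
    have "g * c = 0" "g * star a * star c = 0"
      using perp_inD(2,3)[OF c[unfolded C_def]] g G_right[OF g] by blast+
    then show "g * (c * a) = 0" "g * star (c * a) = 0"
      by (simp_all only: star_mult mult_zero_left flip: mult.assoc)
  qed simp
  have "c * a * c' = 0" if "c \<in> C" "c' \<in> perp_in UNIV C" for c a c'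
    using perp_inD(2)[OF that(2) C_right[OF that(1)]] .
  then have "C \<in> central_annihilators UNIV"
    using C by (simp add: central_annihilators_iff_ideal[OF U])
  moreover have "E = B \<inter> C"
  proof
    have "g * e = 0" if g: "g \<in> G" and e: "e \<in> E" for g e
    proof -
      obtain a f b where "g = a * f * b" "f \<in> ?F" using g unfolding G_def by blast
      then show ?thesis using FAE[OF e, of f b] by (simp add: mult.assoc)
    qed
    then have "E \<subseteq> C"
      unfolding C_def using annihilator_star[OF sub ann] by (intro subsetI perp_inI) simp_all
    then show "E \<subseteq> B \<inter> C" using EB by simp
    have kill_star: "star f * x = 0" if x: "x \<in> C" and f: "f \<in> ?F" for x f
    proof -
      have "star f * f * star f \<in> G" using f unfolding G_def by blast
      then have "star f * f * star f * x = 0" by (rule perp_inD(2)[OF x[unfolded C_def]])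
      then have "star f * f * (star f * x) = 0" by (simp only: mult.assoc)
      then have "f * (star f * x) = 0" by (simp only: star_mult_self_cancel)
      then have "star (star f) * star f * x = 0" by (simp only: star_star mult.assoc)
      then show ?thesis by (simp only: star_mult_self_cancel)
    qed
    have kill: "f * x = 0" if "x \<in> C" "f \<in> ?F" for x f
      using kill_star[OF that(1) perp_in_star[OF sub that(2)]] by (simp only: star_star)
    have "B \<inter> C \<subseteq> perp_in B ?F"
    proof
      fix x assume "x \<in> B \<inter> C"
      then show "x \<in> perp_in B ?F"
        using kill annihilator_star[OF U C] by (intro perp_inI) simp_all
    qed
    then show "B \<inter> C \<subseteq> E" by (simp only: perp_perp_annihilator[OF sub ann])
  qed
  ultimately show ?thesis by blast
qed

theorem corollary3p33:
  fixes B :: "'a::cstar_algebra set"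
  assumes "hereditary_cstar_subalgebra B"
  shows "central_annihilators B = {B \<inter> C | C. C \<in> central_annihilators (UNIV :: 'a set)}"
  using central_restrict[OF assms] central_extend[OF assms] by blast

end
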